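(* Let $\mathcal{A}_T$ be a convergent collaborative editing algorithm for the tree collaborative object $(T,Op_T,Do_T)$ and $\mathcal{A}_D$ a convergent collaborative editing algorithm for a collaborative object $Data=(D,Op_D,Do_D)$. Then the composition of $\mathcal{A}_T$ and $\mathcal{A}_D$ (defined below) is a convergent collaborative editing algorithm for the collaborative object $T(Data)$.
   Context: A collaborative object consists of a set of states, a set $Op$ of operations and a function $Do(s,op)=op(s)$. Several sites share copies of it; each site generates local requests (an operation plus extra information) which are broadcast to all other sites (no message loss). The causality relation $\succ$: $r_1\succ r_2$ iff they are generated by the same site and $r_1$ is generated first, or $r_1$ is executed at the site generating $r_2$ before $r_2$ is generated. A collaborative editing algorithm is given by a set $Env$ of environments (values of the local variables of all sites, including each site's current state), a set $Req$ of requests, a local transition $\varphi_l:Op\times Env\to Env$ followed by emission of a request $r_l$, and a transition $\varphi_e:Req\times Env\to Env$ executed on receipt of an external request. A computation is an interleaving of local steps and receipt steps over all sites respecting causality. The algorithm is convergent if, in every computation, after all requests have been processed all sites hold the same state. $(T,Op_T,Do_T)$: trees $T::=\{\}\mid\{(l_1,id_1)(T),\dots,(l_m,id_m)(T)\}$ with labels and unique identifiers $id\in ID$, with operations $Add,Del,Mv,Ren,Nop$ on identifiers; $Dom(t)$ is the set of identifiers occurring in $t$. $T(Data)$: states are pairs $(t,\delta)$ with $t\in T$ and $\delta:ID\to D$; operations are $op\in Op_T$ and $op_{id}$ for $id\in ID$, $op\in Op_D$; $Do((t,\delta),op_{id})=(t,\delta')$ where $\delta'$ equals $\delta$ except $\delta'(id)=op(\delta(id))$;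 $Do((t,\delta),op)=(Do_T(t,op),\delta')$ where $\delta'$ equals $\delta$ except $\delta'(id)=d_0$ (a fixed default element of $D$) for identifiers $id$ not occurring in $Do_T(t,op)$. Composition: environments are pairs $\langle E_T,E_D\rangle$ with $E_T$ an environment of $\mathcal{A}_T$ and $E_D$ a partial map from $ID$ to environments of $\mathcal{A}_D$, defined on the identifiers of the current tree state; requests are $\langle r_T,\bot\rangle$ with $r_T$ a request of $\mathcal{A}_T$ or $\langle\bot,(id,r_D)\rangle$ with $r_D$ a request of $\mathcal{A}_D$. A local operation $op\in Op_T$ is processed by $\varphi^T_l$ on $E_T$ emitting $\langle r^T_l,\bot\rangle$; a local $op_{id}$ is processed by $\varphi^D_l$ on $E_D(id)$ emitting $\langle\bot,(id,r^D_l)\rangle$; an external request $\langle r^T_e,\bot\rangle$ is processed by $\varphi^T_e$ on $E_T$, and $\langle\bot,(id,r^D_e)\rangle$ by $\varphi^D_e$ on $E_D(id)$. The initial state is the empty tree labelled by $d_0$; the current state is the tree computed by $\mathcal{A}_T$ with, for each identifier $id$ in it, the label computed by $\mathcal{A}_D$ at $id$.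
   Formalization: E_D keeps the environments of identifiers that left the tree, and uses A_D's initial environment where E_D(id) is undefined; if E_D is defined only on current identifiers, re-adding a deleted identifier concurrently with a data operation on it makes the sites' labels diverge. *)

theory Defs
  imports Main "HOL-Library.FSet"
begin

section \<open>Collaborative objects and collaborative editing algorithms\<close>

record ('st, 'op) collab_object =
  States :: "'st set"
  Ops :: "'op set"
  Do :: "'st \<Rightarrow> 'op \<Rightarrow> 'st"

definition collaborative_object :: "('st, 'op) collab_object \<Rightarrow> bool" where
  "collaborative_object Obj \<longleftrightarrow> (\<forall>x \<in> States Obj. \<forall>op \<in> Ops Obj. Do Obj x op \<in> States Obj)"

text \<open>
  An environment is the valuation of the local variables of one site, and \<open>state_of\<close> reads off the
  copy of the object held by that site.  Initial environments and transitions are indexed by the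
  site executing them, since sites may use their own name, for instance to stamp requests.
  \<open>local_step\<close> returns the new environment together with the emitted request.
\<close>

record ('s, 'st, 'op, 'env, 'req) algorithm =
  Env :: "'env set"
  Req :: "'req set"
  init_env :: "'s \<Rightarrow> 'env"
  state_of :: "'env \<Rightarrow> 'st"
  local_step :: "'s \<Rightarrow> 'op \<Rightarrow> 'env \<Rightarrow> 'env \<times> 'req"
  ext_step :: "'s \<Rightarrow> 'req \<Rightarrow> 'env \<Rightarrow> 'env"

definition editing_algorithm ::
  "('st, 'op) collab_object \<Rightarrow> 'st \<Rightarrow> ('s, 'st, 'op, 'env, 'req) algorithm \<Rightarrow> bool" where
  "editing_algorithm Obj x0 A \<longleftrightarrow>
     collaborative_object Obj \<and> x0 \<in> States Obj \<and>
     (\<forall>s. init_env A s \<in> Env A \<and> state_of A (init_env A s) = x0) \<and>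
     (\<forall>e \<in> Env A. state_of A e \<in> States Obj) \<and>
     (\<forall>s. \<forall>op \<in> Ops Obj. \<forall>e \<in> Env A. local_step A s op e \<in> Env A \<times> Req A) \<and>
     (\<forall>s. \<forall>r \<in> Req A. \<forall>e \<in> Env A. ext_step A s r e \<in> Env A)"


section \<open>Computations and convergence\<close>

text \<open>
  \<open>Gen s n op\<close>: site \<open>s\<close> executes its local operation \<open>op\<close> and broadcasts the emitted request.
  \<open>Rcv s n\<close>: site \<open>s\<close> receives and executes that request.  The number \<open>n\<close> is not visible to the
  algorithm; it names the occurrence of the request, because two local steps may emit equal
  elements of \<open>Req\<close>.
\<close>

datatype ('s, 'op) event = Gen 's nat 'op | Rcv 's nat

definition before :: "'e list \<Rightarrow> 'e \<Rightarrow> 'e \<Rightarrow> bool" where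
  "before tr a b \<longleftrightarrow> (\<exists>i j. i < j \<and> j < length tr \<and> tr ! i = a \<and> tr ! j = b)"

definition causes :: "('s, 'op) event list \<Rightarrow> nat \<Rightarrow> nat \<Rightarrow> bool" where
  "causes tr m n \<longleftrightarrow>
     (\<exists>s a b. before tr (Gen s m a) (Gen s n b)) \<or>
     (\<exists>s b. before tr (Rcv s m) (Gen s n b))"

definition computation :: "('st, 'op) collab_object \<Rightarrow> ('s, 'op) event list \<Rightarrow> bool" where
  "computation Obj tr \<longleftrightarrow>
     distinct tr \<and>
     (\<forall>s n op. Gen s n op \<in> set tr \<longrightarrow> op \<in> Ops Obj) \<and>
     (\<forall>s s' n op op'. Gen s n op \<in> set tr \<longrightarrow> Gen s' n op' \<in> set tr \<longrightarrow> s = s' \<and> op = op') \<and>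
     (\<forall>s n. Rcv s n \<in> set tr \<longrightarrow> (\<exists>s' op. s' \<noteq> s \<and> before tr (Gen s' n op) (Rcv s n))) \<and>
     (\<forall>s m n. causes tr m n \<longrightarrow> Rcv s n \<in> set tr \<longrightarrow>
        (\<exists>op. before tr (Gen s m op) (Rcv s n)) \<or> before tr (Rcv s m) (Rcv s n))"

definition all_processed :: "('s, 'op) event list \<Rightarrow> bool" where
  "all_processed tr \<longleftrightarrow> (\<forall>s n op s'. Gen s n op \<in> set tr \<longrightarrow> s' \<noteq> s \<longrightarrow> Rcv s' n \<in> set tr)"

fun exec_event :: "('s, 'st, 'op, 'env, 'req) algorithm \<Rightarrow> ('s, 'op) event \<Rightarrow>
    ('s \<Rightarrow> 'env) \<times> (nat \<rightharpoonup> 'req) \<Rightarrow> ('s \<Rightarrow> 'env) \<times> (nat \<rightharpoonup> 'req)" where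
  "exec_event A (Gen s n op) (E, M) =
     (let (e, r) = local_step A s op (E s) in (E(s := e), M(n \<mapsto> r)))"
| "exec_event A (Rcv s n) (E, M) = (E(s := ext_step A s (the (M n)) (E s)), M)"

definition final_env ::
  "('s, 'st, 'op, 'env, 'req) algorithm \<Rightarrow> ('s, 'op) event list \<Rightarrow> 's \<Rightarrow> 'env" where
  "final_env A tr = fst (fold (exec_event A) tr (init_env A, Map.empty))"

definition convergent_for ::
  "('st, 'op) collab_object \<Rightarrow> ('s, 'st, 'op, 'env, 'req) algorithm \<Rightarrow> bool" where
  "convergent_for Obj A \<longleftrightarrow>
     (\<forall>tr. computation Obj tr \<longrightarrow> all_processed tr \<longrightarrow>
        (\<forall>s s'. state_of A (final_env A tr s) = state_of A (final_env A tr s')))"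


section \<open>The tree object\<close>

datatype (labels: 'l, Dom: 'i) tree = Tree (edges: "('l \<times> 'i \<times> ('l, 'i) tree) fset")

type_synonym ('l, 'i) edge = "'l \<times> 'i \<times> ('l, 'i) tree"

fun edge_ids :: "('l, 'i) edge \<Rightarrow> 'i set" where
  "edge_ids (l, i, t) = insert i (Dom t)"

inductive unique_ids :: "('l, 'i) tree \<Rightarrow> bool" where
  "(\<And>l i t. (l, i, t) |\<in>| F \<Longrightarrow> i \<notin> Dom t \<and> unique_ids t) \<Longrightarrow>
   (\<And>e e'. e |\<in>| F \<Longrightarrow> e' |\<in>| F \<Longrightarrow> e \<noteq> e' \<Longrightarrow> edge_ids e \<inter> edge_ids e' = {}) \<Longrightarrow>
   unique_ids (Tree F)"

inductive edge_in :: "('l, 'i) edge \<Rightarrow> ('l, 'i) tree \<Rightarrow> bool" where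
  "e |\<in>| F \<Longrightarrow> edge_in e (Tree F)"
| "(l, i, t) |\<in>| F \<Longrightarrow> edge_in e t \<Longrightarrow> edge_in e (Tree F)"

primrec rename :: "'i \<Rightarrow> 'l \<Rightarrow> ('l, 'i) tree \<Rightarrow> ('l, 'i) tree" where
  "rename j k (Tree F) =
     Tree ((\<lambda>(l, i, t). (if i = j then k else l, i, t)) |`|
           (map_prod id (map_prod id (rename j k)) |`| F))"

primrec delete :: "'i \<Rightarrow> ('l, 'i) tree \<Rightarrow> ('l, 'i) tree" where
  "delete j (Tree F) =
     Tree (ffilter (\<lambda>(l, i, t). i \<noteq> j) (map_prod id (map_prod id (delete j)) |`| F))"

primrec graft_below :: "'i \<Rightarrow> ('l, 'i) edge \<Rightarrow> ('l, 'i) tree \<Rightarrow> ('l, 'i) tree" where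
  "graft_below p e (Tree F) =
     Tree ((\<lambda>(l, i, t). (l, i, if i = p then Tree (finsert e (edges t)) else t)) |`|
           (map_prod id (map_prod id (graft_below p e)) |`| F))"

text \<open>Identifiers sit on edges, so the root has none; as a parent it is written \<open>None\<close>.\<close>

fun graft :: "'i option \<Rightarrow> ('l, 'i) edge \<Rightarrow> ('l, 'i) tree \<Rightarrow> ('l, 'i) tree" where
  "graft None e t = Tree (finsert e (edges t))"
| "graft (Some p) e t = graft_below p e t"

text \<open>
  \<open>Add p i l\<close> creates a leaf edge \<open>(l, i)\<close> below \<open>p\<close>, \<open>Del i\<close> removes the edge \<open>i\<close> with its
  subtree, \<open>Mv i p\<close> moves the edge \<open>i\<close> with its subtree below \<open>p\<close>, \<open>Ren i l\<close> changes the label of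
  \<open>i\<close>.  An operation that is not applicable leaves the tree unchanged.
\<close>

datatype ('l, 'i) tree_op =
  Add "'i option" 'i 'l | Del 'i | Mv 'i "'i option" | Ren 'i 'l | Nop

fun do_tree :: "('l, 'i) tree \<Rightarrow> ('l, 'i) tree_op \<Rightarrow> ('l, 'i) tree" where
  "do_tree t (Add p i l) =
     (if i \<notin> Dom t \<and> set_option p \<subseteq> Dom t then graft p (l, i, Tree {||}) t else t)"
| "do_tree t (Del i) = delete i t"
| "do_tree t (Mv i p) =
     (if i \<in> Dom t \<and> set_option p \<subseteq> Dom (delete i t)
      then graft p (THE e. edge_in e t \<and> fst (snd e) = i) (delete i t) else t)"
| "do_tree t (Ren i l) = rename i l t"
| "do_tree t Nop = t"

definition tree_object :: "(('l, 'i) tree, ('l, 'i) tree_op) collab_object" where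
  "tree_object = \<lparr>States = {t. unique_ids t}, Ops = UNIV, Do = do_tree\<rparr>"

text \<open>Tree operations preserve uniqueness of identifiers.\<close>

lemma tree_induct [case_names Tree]:
  assumes "\<And>F. (\<And>l i t. (l, i, t) |\<in>| F \<Longrightarrow> P t) \<Longrightarrow> P (Tree F)"
  shows "P t"
proof (induction t)
  case (Tree F)
  have "P t" if "(l, i, t) |\<in>| F" for l i t
    using Tree[of "(l, i, t)" "(i, t)" t] that by simp
  then show ?case by (rule assms)
qed

lemma Dom_Tree: "Dom (Tree F) = (\<Union>e \<in> fset F. edge_ids e)"
  by (force simp: Basic_BNFs.snds.simps Basic_BNFs.fsts.simps)

declare tree.set [simp del]

lemma Dom_finsert: "Dom (Tree (finsert e (edges v))) = edge_ids e \<union> Dom v"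
  by (cases v) (simp add: Dom_Tree)

lemma Dom_rename [simp]: "Dom (rename j k t) = Dom t"
proof (induction t rule: tree_induct)
  case (Tree F)
  have "\<And>l i u. (l,i,u) \<in> fset F \<Longrightarrow> Dom (rename j k u) = Dom u"
    using Tree by (force simp: Basic_BNFs.snds.simps)
  then show ?case
    by (simp add: Dom_Tree del: tree.set) (intro SUP_cong refl, auto)
qed

lemma Dom_delete: "Dom (delete j t) \<subseteq> Dom t"
proof (induction t rule: tree_induct)
  case (Tree F)
  have "\<And>l i u. (l,i,u) \<in> fset F \<Longrightarrow> Dom (delete j u) \<subseteq> Dom u"
    using Tree by (force simp: Basic_BNFs.snds.simps)
  then show ?case
    by (force simp add: Dom_Tree simp del: tree.set)
qed

lemma delete_notin: "j \<notin> Dom (delete j t)"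
proof (induction t rule: tree_induct)
  case (Tree F)
  have "\<And>l i u. (l,i,u) \<in> fset F \<Longrightarrow> j \<notin> Dom (delete j u)"
    using Tree by (force simp: Basic_BNFs.snds.simps)
  then show ?case
    by (force simp add: Dom_Tree simp del: tree.set)
qed

lemma Dom_graft_below: "Dom (graft_below p e t) \<subseteq> Dom t \<union> edge_ids e"
proof (induction t rule: tree_induct)
  case (Tree F)
  have *: "Dom (graft_below p e u) \<subseteq> Dom u \<union> edge_ids e" if "(l,i,u) \<in> fset F" for l i u
    using Tree that by blast
  have "edge_ids ((\<lambda>(l, i, t). (l, i, if i = p then Tree (finsert e (edges t)) else t))
          (map_prod id (map_prod id (graft_below p e)) x)) \<subseteq> edge_ids x \<union> edge_ids e" if "x \<in> fset F" for x
  proof (cases x)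
    case (fields l i u)
    then show ?thesis using *[of l i u] that fields
      by (simp add: fields Dom_finsert del: edge_ids.simps) (auto simp: Dom_finsert edge_ids.simps[of l] simp del: edge_ids.simps)
  qed
  then show ?case by (simp add: Dom_Tree del: tree.set) blast
qed

lemma graft_below_id: "p \<notin> Dom t \<Longrightarrow> graft_below p e t = t"
proof (induction t rule: tree_induct)
  case (Tree F)
  have *: "graft_below p e u = u" "p \<noteq> i" if "(l,i,u) \<in> fset F" for l i u
    using Tree that by (force simp: Basic_BNFs.snds.simps Dom_Tree simp del: tree.set)+
  then have "((\<lambda>(l, i, t). (l, i, if i = p then Tree (finsert e (edges t)) else t)) \<circ>
           (map_prod id (map_prod id (graft_below p e)))) x = x" if "x \<in> fset F" for x
    using that by (cases x) (auto dest: *)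
  then show ?case by (auto simp: fset.map_comp intro!: fset.map_ident_strong)
qed

lemma unique_Tree: "unique_ids (Tree F) \<longleftrightarrow>
   (\<forall>l i t. (l, i, t) |\<in>| F \<longrightarrow> i \<notin> Dom t \<and> unique_ids t) \<and>
   (\<forall>e e'. e |\<in>| F \<longrightarrow> e' |\<in>| F \<longrightarrow> e \<noteq> e' \<longrightarrow> edge_ids e \<inter> edge_ids e' = {})"
  by (subst unique_ids.simps) blast

lemma unique_map:
  assumes "unique_ids (Tree F)"
    and "\<And>l i u. (l,i,u) |\<in>| F \<Longrightarrow> unique_ids u \<Longrightarrow> i \<notin> Dom u \<Longrightarrow> (case f (l,i,u) of (l',i',u') \<Rightarrow> i' \<notin> Dom u' \<and> unique_ids u')"
    and "\<And>x y. x |\<in>| F \<Longrightarrow> y |\<in>| F \<Longrightarrow> x \<noteq> y \<Longrightarrow> edge_ids x \<inter> edge_ids y = {} \<Longrightarrow> edge_ids (f x) \<inter> edge_ids (f y) = {}"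
  shows "unique_ids (Tree (f |`| F))"
  unfolding unique_Tree
proof (intro conjI allI impI)
  fix l i t assume "(l,i,t) |\<in>| f |`| F"
  then obtain x where x: "x |\<in>| F" "f x = (l,i,t)" by auto
  show "i \<notin> Dom t" "unique_ids t"
    using x assms(1,2) unfolding unique_Tree by (cases x; fastforce)+
next
  fix e e' assume "e |\<in>| f |`| F" "e' |\<in>| f |`| F" "e \<noteq> e'"
  then obtain x y where "x |\<in>| F" "y |\<in>| F" "x \<noteq> y" "e = f x" "e' = f y" by blast
  with assms(1,3) show "edge_ids e \<inter> edge_ids e' = {}" unfolding unique_Tree by blast
qed

lemma unique_rename: "unique_ids t \<Longrightarrow> unique_ids (rename j k t)"
proof (induction t rule: tree_induct)
  case (Tree F)
  have *: "unique_ids (rename j k u)" if "(l,i,u) \<in> fset F" "unique_ids u" for l i u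
    using Tree that by blast
  have "unique_ids (Tree ((\<lambda>x. (\<lambda>(l, i, t). (if i = j then k else l, i, t)) (map_prod id (map_prod id (rename j k)) x)) |`| F))"
    by (rule unique_map[OF Tree.prems]) (auto simp: *)
  then show ?case by (simp add: fset.map_comp comp_def)
qed

lemma unique_sub: "unique_ids (Tree F) \<Longrightarrow> G |\<subseteq>| F \<Longrightarrow> unique_ids (Tree G)"
  unfolding unique_Tree by blast

lemma unique_delete: "unique_ids (t :: ('l,'i) tree) \<Longrightarrow> unique_ids (delete j t)"
proof (induction t rule: tree_induct)
  case (Tree F)
  have *: "unique_ids (delete j u)" if "(l,i,u) \<in> fset F" "unique_ids u" for l i u
    using Tree that by blast
  have **: "edge_ids (map_prod id (map_prod id (delete j)) x) \<subseteq> edge_ids x" for x :: "('l,'i) edge"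
    using Dom_delete by (cases x) fastforce
  have "unique_ids (Tree (map_prod id (map_prod id (delete j)) |`| F))"
  proof (rule unique_map[OF Tree.prems], goal_cases)
    case (1 l i u) then show ?case using * Dom_delete by fastforce
  next
    case (2 x y) then show ?case using **[of x] **[of y] by blast
  qed
  then show ?case by (auto intro: unique_sub)
qed

lemma unique_insert:
  assumes "unique_ids v" "unique_ids u" "i \<notin> Dom u" "edge_ids (l,i,u) \<inter> Dom v = {}"
  shows "unique_ids (Tree (finsert (l,i,u) (edges v)))"
proof (cases v)
  case (Tree F)
  have "edge_ids e \<inter> edge_ids (l,i,u) = {}" if "e |\<in>| F" for e
    using assms(4) that unfolding Tree Dom_Tree by blast
  with assms(1-3) show ?thesis
    unfolding Tree unique_Tree tree.sel by (auto simp del: edge_ids.simps)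
qed

lemma unique_graft_below:
  fixes t :: "('l, 'i) tree"
  assumes "unique_ids u" "i \<notin> Dom u"
  shows "unique_ids t \<Longrightarrow> edge_ids (l,i,u) \<inter> Dom t = {} \<Longrightarrow> unique_ids (graft_below p (l,i,u) t)"
proof (induction t rule: tree_induct)
  case (Tree F)
  let ?e = "(l,i,u)"
  let ?f = "\<lambda>x. (\<lambda>(l, i, t). (l, i, if i = p then Tree (finsert ?e (edges t)) else t)) (map_prod id (map_prod id (graft_below p ?e)) x)"
  have disj: "edge_ids x \<inter> edge_ids ?e = {}" if "x |\<in>| F" for x
    using Tree.prems(2) that unfolding Dom_Tree by blast
  have *: "unique_ids (graft_below p ?e u)" if "(l,i,u) |\<in>| F" "unique_ids u" for l i u
    using Tree that disj[of "(l,i,u)"] by (force simp: Basic_BNFs.snds.simps)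
  have sub: "edge_ids (?f x) \<subseteq> edge_ids x \<union> edge_ids ?e" for x :: "('l,'i) edge"
  proof (cases x)
    case (fields l i u)
    show ?thesis using Dom_graft_below[of p ?e u]
      by (simp add: fields Dom_finsert del: edge_ids.simps) (auto simp: Dom_finsert edge_ids.simps[of l] simp del: edge_ids.simps)
  qed
  have idem: "edge_ids (?f x) = edge_ids x" if "p \<notin> edge_ids x" for x :: "('l,'i) edge"
    using that graft_below_id[of p _ ?e] by (cases x) auto
  have "unique_ids (Tree (?f |`| F))"
  proof (rule unique_map[OF Tree.prems(1)], goal_cases)
    case (1 l' i' u')
    have d: "i' \<notin> edge_ids ?e" "edge_ids ?e \<inter> Dom u' = {}" using disj[OF 1(1)] by auto
    then have g: "i' \<notin> Dom (graft_below p ?e u')" using 1 Dom_graft_below[of p ?e u'] by blast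
    have "unique_ids (Tree (finsert ?e (edges u')))" by (rule unique_insert) (use assms 1 d in blast)+
    then have "i' = p \<Longrightarrow> ?case" 
      using 1 d(1) graft_below_id[of p u' ?e] by (simp add: Dom_finsert del: edge_ids.simps)
    moreover have "i' \<noteq> p \<Longrightarrow> ?case" using *[OF 1(1,2)] g by simp
    ultimately show ?case by (cases "i' = p")
  next
    case (2 x y)
    then have "p \<notin> edge_ids x \<or> p \<notin> edge_ids y" by blast
    then show ?case
      using 2 sub[of x] sub[of y] idem[of x] idem[of y] disj[of x] disj[of y] by blast
  qed
  then show ?case by (simp add: fset.map_comp comp_def)
qed

lemma unique_graft:
  assumes "unique_ids u" "i \<notin> Dom u" "unique_ids t" "edge_ids (l,i,u) \<inter> Dom t = {}"
  shows "unique_ids (graft p (l,i,u) t)"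
  using assms unique_graft_below unique_insert by (cases p) (simp_all del: edge_ids.simps)

lemma edge_in_Dom: "edge_in e t \<Longrightarrow> edge_ids e \<subseteq> Dom t"
  by (induction rule: edge_in.induct) (force simp: Dom_Tree simp del: tree.set)+

lemma edge_in_Dom1: "edge_in (l,i,u) t \<Longrightarrow> i \<in> Dom t"
  using edge_in_Dom by fastforce

lemma edge_in_ex: "i \<in> Dom t \<Longrightarrow> \<exists>l u. edge_in (l,i,u) t"
proof (induction t rule: tree_induct)
  case (Tree F)
  then obtain l' i' u' where m: "(l',i',u') |\<in>| F" "i \<in> edge_ids (l',i',u')"
    unfolding Dom_Tree by fastforce
  show ?case
  proof (cases "i = i'")
    case True then show ?thesis using m edge_in.intros by fast
  next
    case False
    then have "\<exists>l u. edge_in (l,i,u) u'"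
      using Tree.IH m by auto
    then show ?thesis using m edge_in.intros by fast
  qed
qed

lemma edge_in_Tree: "edge_in e (Tree F) \<longleftrightarrow> e |\<in>| F \<or> (\<exists>l i t. (l,i,t) |\<in>| F \<and> edge_in e t)"
  by (subst edge_in.simps) auto

lemma delete_id: "j \<notin> Dom t \<Longrightarrow> delete j t = t"
proof (induction t rule: tree_induct)
  case (Tree F)
  have *: "delete j u = u" "j \<noteq> i" if "(l,i,u) \<in> fset F" for l i u
    using Tree that by (force simp: Basic_BNFs.snds.simps Dom_Tree simp del: tree.set)+
  have "map_prod id (map_prod id (delete j)) |`| F = F"
    by (rule fset.map_ident_strong) (use * in auto)
  then show ?case using *(2)[of _ j] by (auto intro!: fset_eqI)
qed

lemma edge_in_unique:
  fixes t :: "('l, 'i) tree"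
  shows "edge_in (l,i,u) t \<Longrightarrow> unique_ids t \<Longrightarrow> i \<notin> Dom u \<and> unique_ids u \<and> edge_ids (l,i,u) \<inter> Dom (delete i t) = {}
     \<and> (\<forall>l' u'. edge_in (l',i,u') t \<longrightarrow> l' = l \<and> u' = u)"
proof (induction t rule: tree_induct)
  case (Tree F)
  note U = Tree.prems(2)[unfolded unique_Tree]
  from Tree.prems(1) obtain l0 i0 u0 where m: "(l0,i0,u0) |\<in>| F"
    and c: "(l,i,u) = (l0,i0,u0) \<or> edge_in (l,i,u) u0" unfolding edge_in_Tree by auto
  have i: "i \<in> edge_ids (l0,i0,u0)" using c edge_in_Dom1 by fastforce
  have sub: "edge_ids (l,i,u) \<subseteq> edge_ids (l0,i0,u0)" using c edge_in_Dom by fastforce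
  have other: "edge_ids x \<inter> edge_ids (l0,i0,u0) = {}" if "x |\<in>| F" "x \<noteq> (l0,i0,u0)" for x
    using U m that by blast
  have disjI: "edge_ids (l,i,u) \<inter> Dom (delete i (Tree F)) = {}"
    if disj: "\<And>x. x |\<in>| F \<Longrightarrow> fst (snd x) \<noteq> i \<Longrightarrow> edge_ids (l,i,u) \<inter> edge_ids (map_prod id (map_prod id (delete i)) x) = {}"
  proof -
    have "edge_ids (l,i,u) \<inter> edge_ids y = {}" if "y \<in> fset (edges (delete i (Tree F)))" for y
    proof -
      from that obtain x where "x |\<in>| F" "fst (snd x) \<noteq> i" "y = map_prod id (map_prod id (delete i)) x"
        by auto
      with disj show ?thesis by blast
    qed
    then show ?thesis by (simp only: delete.simps Dom_Tree tree.sel) blast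
  qed
  have dsub: "edge_ids (map_prod id (map_prod id (delete i)) x) \<subseteq> edge_ids x" for x :: "('l,'i) edge"
    using Dom_delete by (cases x) fastforce
  show ?case
  proof (cases "i = i0")
    case True
    have "i \<notin> Dom u0" using U m True by blast
    then have "\<not> edge_in (l,i,u) u0" using edge_in_Dom1 by metis
    then have [simp]: "l = l0" "u = u0" using c by auto
    have "edge_ids (l,i,u) \<inter> Dom (delete i (Tree F)) = {}"
    proof (rule disjI)
      fix x assume x: "x |\<in>| F" "fst (snd x) \<noteq> i"
      then have "x \<noteq> (l0,i0,u0)" using True by auto
      then show "edge_ids (l,i,u) \<inter> edge_ids (map_prod id (map_prod id (delete i)) x) = {}"
        using other[OF x(1)] dsub[of x] sub by blast
    qed
    moreover have "l' = l \<and> u' = u" if "edge_in (l',i,u') (Tree F)" for l' u'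
    proof -
      obtain l1 i1 u1 where m1: "(l1,i1,u1) |\<in>| F"
        and c1: "(l',i,u') = (l1,i1,u1) \<or> edge_in (l',i,u') u1" using \<open>edge_in (l',i,u') (Tree F)\<close> unfolding edge_in_Tree by auto
      have "i \<in> edge_ids (l1,i1,u1)" using c1 edge_in_Dom1 by fastforce
      then have "(l1,i1,u1) = (l0,i0,u0)" using other[OF m1] i by blast
      then show ?thesis using c1 \<open>i \<notin> Dom u0\<close> edge_in_Dom1[of l' i u' u0] by auto
    qed
    moreover have "i \<notin> Dom u" "unique_ids u" using U m True by auto
    ultimately show ?thesis by blast
  next
    case False
    then have e: "edge_in (l,i,u) u0" using c by auto
    have IH: "i \<notin> Dom u \<and> unique_ids u \<and> edge_ids (l,i,u) \<inter> Dom (delete i u0) = {}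
     \<and> (\<forall>l' u'. edge_in (l',i,u') u0 \<longrightarrow> l' = l \<and> u' = u)"
      using Tree.IH[OF m e] m U by blast
    have "i0 \<notin> edge_ids (l,i,u)" using edge_in_Dom[OF e] U m by blast
    then have "edge_ids (l,i,u) \<inter> Dom (delete i (Tree F)) = {}"
    proof (intro disjI)
      fix x assume x: "x |\<in>| F"
      show "edge_ids (l,i,u) \<inter> edge_ids (map_prod id (map_prod id (delete i)) x) = {}"
      proof (cases "x = (l0,i0,u0)")
        case True
        then show ?thesis using IH \<open>i0 \<notin> edge_ids (l,i,u)\<close>
          by (simp only: map_prod_simp id_apply edge_ids.simps[of l0]) blast
      next
        case False
        then show ?thesis using other[OF x] dsub[of x] sub by blast
      qed
    qed
    moreover have "l' = l \<and> u' = u" if "edge_in (l',i,u') (Tree F)" for l' u'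
    proof -
      obtain l1 i1 u1 where m1: "(l1,i1,u1) |\<in>| F"
        and c1: "(l',i,u') = (l1,i1,u1) \<or> edge_in (l',i,u') u1" using \<open>edge_in (l',i,u') (Tree F)\<close> unfolding edge_in_Tree by auto
      have "i \<in> edge_ids (l1,i1,u1)" using c1 edge_in_Dom1 by fastforce
      then have "(l1,i1,u1) = (l0,i0,u0)" using other[OF m1] i by blast
      then show ?thesis using c1 False IH by auto
    qed
    ultimately show ?thesis using IH by blast
  qed
qed

lemma unique_do_tree: "unique_ids t \<Longrightarrow> unique_ids (do_tree t op)"
proof (cases op)
  case (Add p i l)
  assume "unique_ids t"
  moreover have "unique_ids (Tree {||})" by (simp add: unique_Tree)
  ultimately have "i \<notin> Dom t \<Longrightarrow> unique_ids (graft p (l, i, Tree {||}) t)"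
    using unique_graft[of "Tree {||}" i t l p] by (simp add: Dom_Tree del: graft.simps)
  then show ?thesis using \<open>unique_ids t\<close> unfolding Add do_tree.simps by presburger
next
  case (Mv i p)
  assume t: "unique_ids t"
  show ?thesis
  proof (cases "i \<in> Dom t")
    case True
    then obtain l u where e: "edge_in (l,i,u) t" using edge_in_ex by fast
    note E = edge_in_unique[OF e t]
    have "(THE e. edge_in e t \<and> fst (snd e) = i) = (l,i,u)"
    proof (rule the_equality)
      show "edge_in (l,i,u) t \<and> fst (snd (l,i,u)) = i" using e by simp
    next
      fix e' assume "edge_in e' t \<and> fst (snd e') = i"
      then show "e' = (l,i,u)" using E by (metis prod.collapse)
    qed
    then show ?thesis using Mv t E by (simp add: unique_graft unique_delete)
  qed (use t Mv in simp)
qed (simp_all add: unique_rename unique_delete)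

lemma collaborative_object_tree: "collaborative_object tree_object"
  by (simp add: collaborative_object_def tree_object_def unique_do_tree)


section \<open>Trees with data\<close>

datatype ('opt, 'i, 'opd) data_tree_op = Tree_op 'opt | Data_op 'i 'opd

fun do_data_tree :: "('d, 'opd) collab_object \<Rightarrow> 'd \<Rightarrow> ('l, 'i) tree \<times> ('i \<Rightarrow> 'd) \<Rightarrow>
    (('l, 'i) tree_op, 'i, 'opd) data_tree_op \<Rightarrow> ('l, 'i) tree \<times> ('i \<Rightarrow> 'd)" where
  "do_data_tree Data d0 (t, \<delta>) (Data_op i op) = (t, \<delta>(i := Do Data (\<delta> i) op))"
| "do_data_tree Data d0 (t, \<delta>) (Tree_op op) =
     (let t' = Do tree_object t op in (t', \<lambda>i. if i \<in> Dom t' then \<delta> i else d0))"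

definition data_tree_object :: "('d, 'opd) collab_object \<Rightarrow> 'd \<Rightarrow>
    (('l, 'i) tree \<times> ('i \<Rightarrow> 'd), (('l, 'i) tree_op, 'i, 'opd) data_tree_op) collab_object" where
  "data_tree_object Data d0 =
     \<lparr>States = {(t, \<delta>). t \<in> States tree_object \<and> range \<delta> \<subseteq> States Data},
      Ops = Tree_op ` Ops tree_object \<union> {Data_op i op | i op. op \<in> Ops Data},
      Do = do_data_tree Data d0\<rparr>"


section \<open>Composition of algorithms\<close>

text \<open>The requests \<open>\<langle>r, \<bottom>\<rangle>\<close> and \<open>\<langle>\<bottom>, (i, r)\<rangle>\<close>.\<close>

datatype ('rt, 'i, 'rd) comp_req = Tree_req 'rt | Data_req 'i 'rd

text \<open>
  Every identifier of the current tree has a data environment, which is the initial one until some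
  request has modified it.  The data environment of an identifier that leaves the tree is kept:
  a convergent tree algorithm may show the identifier again later, or show it at one site before it
  does so at another, and discarding the data requests that are processed in the meantime would
  make the sites diverge.  Likewise a data request on an identifier that is not yet in the domain is
  processed from the initial environment.
\<close>

definition data_env :: "('s, 'd, 'opd, 'ed, 'rd) algorithm \<Rightarrow> 's \<Rightarrow> ('i \<rightharpoonup> 'ed) \<Rightarrow> 'i \<Rightarrow> 'ed" where
  "data_env AD s ED i = (case ED i of None \<Rightarrow> init_env AD s | Some e \<Rightarrow> e)"

definition cover :: "('s, 'd, 'opd, 'ed, 'rd) algorithm \<Rightarrow> 's \<Rightarrow> 'i set \<Rightarrow>
    ('i \<rightharpoonup> 'ed) \<Rightarrow> ('i \<rightharpoonup> 'ed)" where
  "cover AD s I ED = (\<lambda>i. if i \<in> I then Some (data_env AD s ED i) else ED i)"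

context
  fixes AT :: "('s, ('l, 'i) tree, ('l, 'i) tree_op, 'et, 'rt) algorithm"
    and AD :: "('s, 'd, 'opd, 'ed, 'rd) algorithm"
    and d0 :: 'd
begin

fun comp_local :: "'s \<Rightarrow> (('l, 'i) tree_op, 'i, 'opd) data_tree_op \<Rightarrow> 'et \<times> ('i \<rightharpoonup> 'ed) \<Rightarrow>
    ('et \<times> ('i \<rightharpoonup> 'ed)) \<times> ('rt, 'i, 'rd) comp_req" where
  "comp_local s (Tree_op op) (ET, ED) =
     (let (ET', r) = local_step AT s op ET
      in ((ET', cover AD s (Dom (state_of AT ET')) ED), Tree_req r))"
| "comp_local s (Data_op i op) (ET, ED) =
     (let (e, r) = local_step AD s op (data_env AD s ED i)
      in ((ET, ED(i \<mapsto> e)), Data_req i r))"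

fun comp_ext :: "'s \<Rightarrow> ('rt, 'i, 'rd) comp_req \<Rightarrow> 'et \<times> ('i \<rightharpoonup> 'ed) \<Rightarrow> 'et \<times> ('i \<rightharpoonup> 'ed)" where
  "comp_ext s (Tree_req r) (ET, ED) =
     (let ET' = ext_step AT s r ET in (ET', cover AD s (Dom (state_of AT ET')) ED))"
| "comp_ext s (Data_req i r) (ET, ED) =
     (ET, ED(i \<mapsto> ext_step AD s r (data_env AD s ED i)))"

fun comp_state :: "'et \<times> ('i \<rightharpoonup> 'ed) \<Rightarrow> ('l, 'i) tree \<times> ('i \<Rightarrow> 'd)" where
  "comp_state (ET, ED) =
     (state_of AT ET,
      \<lambda>i. if i \<in> Dom (state_of AT ET) then state_of AD (the (ED i)) else d0)"

definition composition :: "('s, ('l, 'i) tree \<times> ('i \<Rightarrow> 'd),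
    (('l, 'i) tree_op, 'i, 'opd) data_tree_op, 'et \<times> ('i \<rightharpoonup> 'ed), ('rt, 'i, 'rd) comp_req) algorithm"
  where
  "composition =
     \<lparr>Env = {(ET, ED). ET \<in> Env AT \<and> ran ED \<subseteq> Env AD \<and> Dom (state_of AT ET) \<subseteq> dom ED},
      Req = Tree_req ` Req AT \<union> {Data_req i r | i r. r \<in> Req AD},
      init_env = (\<lambda>s. (init_env AT s, Map.empty)),
      state_of = comp_state,
      local_step = comp_local,
      ext_step = comp_ext\<rparr>"

end

end

theory Submission
  imports Defs
begin

text \<open>
  A trace of the composition is projected onto the requests of one component: the tree, or the data
  of one fixed identifier.  Since causality between requests of that component is witnessed by
  events of that component, the projection is again a computation, and it is complete if
  the given one is.  Because the composition never discards data environments, the part of each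
  environment seen by that component evolves exactly as in the execution of the projected trace,
  so convergence of every component gives convergence of the composition.
\<close>

section \<open>Projecting traces\<close>

lemma before_Nil [simp]: "\<not> before [] a b"
  by (simp add: before_def)

lemma before_Cons [simp]: "before (x # xs) a b \<longleftrightarrow> x = a \<and> b \<in> set xs \<or> before xs a b"
proof
  assume "before (x # xs) a b"
  then obtain i j where ij: "i < j" "j < length (x # xs)" "(x # xs) ! i = a" "(x # xs) ! j = b"
    unfolding before_def by blast
  then obtain j' where j: "j = Suc j'" by (cases j) auto
  show "x = a \<and> b \<in> set xs \<or> before xs a b"
  proof (cases i)
    case 0
    then show ?thesis using ij j by auto
  next
    case (Suc i')
    then have "before xs a b" using ij j unfolding before_def by auto
    then show ?thesis ..
  qed
next
  assume "x = a \<and> b \<in> set xs \<or> before xs a b"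
  then show "before (x # xs) a b"
  proof
    assume "x = a \<and> b \<in> set xs"
    then obtain k where "k < length xs" "xs ! k = b" "x = a" by (auto simp: in_set_conv_nth)
    then show ?thesis unfolding before_def by (intro exI[of _ 0] exI[of _ "Suc k"]) auto
  next
    assume "before xs a b"
    then obtain i j where "i < j" "j < length xs" "xs ! i = a" "xs ! j = b"
      unfolding before_def by blast
    then show ?thesis unfolding before_def by (intro exI[of _ "Suc i"] exI[of _ "Suc j"]) auto
  qed
qed

lemma before_in_set: "before xs a b \<Longrightarrow> a \<in> set xs \<and> b \<in> set xs"
  by (induction xs) auto

lemma in_set_map_filter: "y \<in> set (List.map_filter f xs) \<longleftrightarrow> (\<exists>x \<in> set xs. f x = Some y)"
  by (induction xs) (auto split: option.splits)

lemma before_map_filter: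
  "before (List.map_filter f xs) a b \<longleftrightarrow> (\<exists>x y. before xs x y \<and> f x = Some a \<and> f y = Some b)"
  by (induction xs)
    (auto simp: in_set_map_filter split: option.splits)

lemma distinct_map_filter:
  assumes "distinct xs"
    and "\<And>x y z. x \<in> set xs \<Longrightarrow> y \<in> set xs \<Longrightarrow> f x = Some z \<Longrightarrow> f y = Some z \<Longrightarrow> x = y"
  shows "distinct (List.map_filter f xs)"
  using assms
proof (induction xs)
  case (Cons a xs)
  have "distinct (List.map_filter f xs)"
    using Cons.IH Cons.prems by (metis distinct.simps(2) list.set_intros(2))
  moreover have "z \<notin> set (List.map_filter f xs)" if "f a = Some z" for z
    using Cons.prems that by (auto simp: in_set_map_filter)
  ultimately show ?case by (auto split: option.splits)
qed simp

text \<open>A receipt does not show its operation, so it is selected by the name of its request.\<close>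

fun proj_event :: "('a \<Rightarrow> 'b option) \<Rightarrow> nat set \<Rightarrow> ('s, 'a) event \<Rightarrow> ('s, 'b) event option" where
  "proj_event sel N (Gen s n op) = map_option (Gen s n) (sel op)"
| "proj_event sel N (Rcv s n) = (if n \<in> N then Some (Rcv s n) else None)"

definition selected :: "('a \<Rightarrow> 'b option) \<Rightarrow> ('s, 'a) event list \<Rightarrow> nat set" where
  "selected sel tr = {n. \<exists>s op op'. Gen s n op \<in> set tr \<and> sel op = Some op'}"

definition project :: "('a \<Rightarrow> 'b option) \<Rightarrow> ('s, 'a) event list \<Rightarrow> ('s, 'b) event list" where
  "project sel tr = List.map_filter (proj_event sel (selected sel tr)) tr"

lemma proj_event_Gen:
  "proj_event sel N e = Some (Gen s n op') \<longleftrightarrow> (\<exists>op. e = Gen s n op \<and> sel op = Some op')"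
  by (cases e) auto

lemma proj_event_Rcv: "proj_event sel N e = Some (Rcv s n) \<longleftrightarrow> e = Rcv s n \<and> n \<in> N"
  by (cases e) auto

lemma Gen_in_project:
  "Gen s n op' \<in> set (project sel tr) \<longleftrightarrow> (\<exists>op. Gen s n op \<in> set tr \<and> sel op = Some op')"
  by (auto simp: project_def in_set_map_filter proj_event_Gen)

lemma Rcv_in_project:
  "Rcv s n \<in> set (project sel tr) \<longleftrightarrow> Rcv s n \<in> set tr \<and> n \<in> selected sel tr"
  by (auto simp: project_def in_set_map_filter proj_event_Rcv)

lemma before_project:
  "before (project sel tr) a b \<longleftrightarrow> (\<exists>x y. before tr x y \<and>
     proj_event sel (selected sel tr) x = Some a \<and> proj_event sel (selected sel tr) y = Some b)"
  by (simp add: project_def before_map_filter)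

lemma computation_distinct: "computation Obj tr \<Longrightarrow> distinct tr"
  and computation_Ops: "computation Obj tr \<Longrightarrow> Gen s n op \<in> set tr \<Longrightarrow> op \<in> Ops Obj"
  and computation_Gen_unique: "computation Obj tr \<Longrightarrow> Gen s n op \<in> set tr \<Longrightarrow>
    Gen s' n op' \<in> set tr \<Longrightarrow> s = s' \<and> op = op'"
  and computation_Rcv: "computation Obj tr \<Longrightarrow> Rcv s n \<in> set tr \<Longrightarrow>
    \<exists>s' op. s' \<noteq> s \<and> before tr (Gen s' n op) (Rcv s n)"
  and computation_causal: "computation Obj tr \<Longrightarrow> causes tr m n \<Longrightarrow> Rcv s n \<in> set tr \<Longrightarrow>
    (\<exists>op. before tr (Gen s m op) (Rcv s n)) \<or> before tr (Rcv s m) (Rcv s n)"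
  by (simp_all add: computation_def)

lemma selected_iff:
  assumes "computation Obj tr" "Gen s n op \<in> set tr"
  shows "n \<in> selected sel tr \<longleftrightarrow> (\<exists>op'. sel op = Some op')"
  using computation_Gen_unique[OF assms] assms(2) unfolding selected_def by blast

lemma causes_project:
  assumes "causes (project sel tr) m n"
  shows "causes tr m n" and "m \<in> selected sel tr"
proof -
  consider s a b where "before (project sel tr) (Gen s m a) (Gen s n b)"
    | s b where "before (project sel tr) (Rcv s m) (Gen s n b)"
    using assms unfolding causes_def by blast
  then show "causes tr m n"
    by cases (auto simp: before_project proj_event_Gen proj_event_Rcv causes_def)
  from assms show "m \<in> selected sel tr"
    unfolding causes_def
    by (auto simp: before_project proj_event_Gen proj_event_Rcv selected_def dest!: before_in_set)
qed

lemma computation_project: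
  assumes tr: "computation Obj tr"
    and Ops: "\<And>op op'. op \<in> Ops Obj \<Longrightarrow> sel op = Some op' \<Longrightarrow> op' \<in> Ops Obj'"
  shows "computation Obj' (project sel tr)"
  unfolding computation_def
proof (intro conjI allI impI)
  show "distinct (project sel tr)"
    unfolding project_def
  proof (rule distinct_map_filter[OF computation_distinct[OF tr]])
    fix x y z
    assume "x \<in> set tr" "y \<in> set tr" "proj_event sel (selected sel tr) x = Some z"
      "proj_event sel (selected sel tr) y = Some z"
    then show "x = y"
      using computation_Gen_unique[OF tr] by (cases z) (auto simp: proj_event_Gen proj_event_Rcv)
  qed
next
  fix s n op
  assume "Gen s n op \<in> set (project sel tr)"
  then show "op \<in> Ops Obj'"
    using Ops computation_Ops[OF tr] unfolding Gen_in_project by blast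
next
  fix s s' n op op'
  assume "Gen s n op \<in> set (project sel tr)" "Gen s' n op' \<in> set (project sel tr)"
  then obtain a b where "Gen s n a \<in> set tr" "sel a = Some op" "Gen s' n b \<in> set tr" "sel b = Some op'"
    by (auto simp: Gen_in_project)
  then show "s = s'" "op = op'" using computation_Gen_unique[OF tr] by fastforce+
next
  fix s n
  assume "Rcv s n \<in> set (project sel tr)"
  then have n: "Rcv s n \<in> set tr" "n \<in> selected sel tr" by (auto simp: Rcv_in_project)
  then obtain s' op where s': "s' \<noteq> s" "before tr (Gen s' n op) (Rcv s n)"
    using computation_Rcv[OF tr] by blast
  then obtain op' where "sel op = Some op'"
    using selected_iff[OF tr] n(2) before_in_set by metis
  then have "before (project sel tr) (Gen s' n op') (Rcv s n)"
    using s' n unfolding before_project proj_event_Gen proj_event_Rcv by blast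
  with s' show "\<exists>s' op. s' \<noteq> s \<and> before (project sel tr) (Gen s' n op) (Rcv s n)" by blast
next
  fix s m n
  assume c: "causes (project sel tr) m n" and "Rcv s n \<in> set (project sel tr)"
  then have n: "Rcv s n \<in> set tr" "n \<in> selected sel tr" by (auto simp: Rcv_in_project)
  note m = causes_project[OF c]
  from computation_causal[OF tr m(1) n(1)]
  show "(\<exists>op. before (project sel tr) (Gen s m op) (Rcv s n)) \<or>
    before (project sel tr) (Rcv s m) (Rcv s n)"
  proof (elim disjE exE)
    fix op
    assume b: "before tr (Gen s m op) (Rcv s n)"
    then obtain op' where "sel op = Some op'"
      using selected_iff[OF tr] m(2) before_in_set by metis
    then show ?thesis using b n unfolding before_project proj_event_Gen proj_event_Rcv by blast
  next
    assume "before tr (Rcv s m) (Rcv s n)"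
    then show ?thesis using m n unfolding before_project proj_event_Rcv by blast
  qed
qed

lemma all_processed_project: "all_processed tr \<Longrightarrow> all_processed (project sel tr)"
  by (force simp: all_processed_def Gen_in_project Rcv_in_project selected_def)


section \<open>Components of an algorithm\<close>

text \<open>\<open>view s e\<close> is the environment of the component \<open>B\<close> inside the environment \<open>e\<close> of \<open>A\<close>.\<close>

locale component =
  fixes A :: "('s, 'st, 'op, 'env, 'req) algorithm"
    and B :: "('s, 'st', 'op', 'env', 'req') algorithm"
    and sel_op :: "'op \<Rightarrow> 'op' option"
    and sel_req :: "'req \<Rightarrow> 'req' option"
    and view :: "'s \<Rightarrow> 'env \<Rightarrow> 'env'"
  assumes init: "view s (init_env A s) = init_env B s"
    and local_Some: "\<lbrakk>sel_op op = Some op'; local_step A s op e = (e', r)\<rbrakk> \<Longrightarrow>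
      \<exists>r'. sel_req r = Some r' \<and> local_step B s op' (view s e) = (view s e', r')"
    and local_None: "\<lbrakk>sel_op op = None; local_step A s op e = (e', r)\<rbrakk> \<Longrightarrow>
      sel_req r = None \<and> view s e' = view s e"
    and ext_Some: "sel_req r = Some r' \<Longrightarrow> view s (ext_step A s r e) = ext_step B s r' (view s e)"
    and ext_None: "sel_req r = None \<Longrightarrow> view s (ext_step A s r e) = view s e"
begin

definition view_config :: "('s \<Rightarrow> 'env) \<times> (nat \<rightharpoonup> 'req) \<Rightarrow> ('s \<Rightarrow> 'env') \<times> (nat \<rightharpoonup> 'req')" where
  "view_config = (\<lambda>(E, M). (\<lambda>s. view s (E s), \<lambda>n. Option.bind (M n) sel_req))"

lemma view_exec_event:
  assumes "\<And>s n op. x = Gen s n op \<Longrightarrow> M n = None"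
    and "\<And>s n. x = Rcv s n \<Longrightarrow> \<exists>r. M n = Some r \<and> (n \<in> N \<longleftrightarrow> sel_req r \<noteq> None)"
  shows "view_config (exec_event A x (E, M)) =
    (case proj_event sel_op N x of None \<Rightarrow> view_config (E, M)
     | Some y \<Rightarrow> exec_event B y (view_config (E, M)))"
proof (cases x)
  case (Gen s n op)
  obtain e r where l: "local_step A s op (E s) = (e, r)" by fastforce
  show ?thesis
  proof (cases "sel_op op")
    case None
    then show ?thesis
      using local_None[OF None l] l assms(1)[OF Gen] by (auto simp: Gen view_config_def fun_eq_iff)
  next
    case (Some op')
    then show ?thesis
      using local_Some[OF Some l] l by (auto simp: Gen view_config_def fun_eq_iff)
  qed
next
  case (Rcv s n)
  then obtain r where "M n = Some r" "n \<in> N \<longleftrightarrow> sel_req r \<noteq> None" using assms(2) by blast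
  then show ?thesis
    by (cases "sel_req r") (auto simp: Rcv view_config_def fun_eq_iff ext_Some ext_None)
qed

lemma view_fold_exec_event:
  assumes "distinct tr"
    and "\<And>s s' n op op'. Gen s n op \<in> set tr \<Longrightarrow> Gen s' n op' \<in> set tr \<Longrightarrow> s = s' \<and> op = op'"
    and "\<And>s n. Rcv s n \<in> set tr \<Longrightarrow>
      n \<in> dom (snd EM) \<or> (\<exists>s' op. before tr (Gen s' n op) (Rcv s n))"
    and "\<And>s n op. Gen s n op \<in> set tr \<Longrightarrow> snd EM n = None"
    and "\<And>s n op. Gen s n op \<in> set tr \<Longrightarrow> n \<in> N \<longleftrightarrow> sel_op op \<noteq> None"
    and "\<And>n r. snd EM n = Some r \<Longrightarrow> n \<in> N \<longleftrightarrow> sel_req r \<noteq> None"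
  shows "view_config (fold (exec_event A) tr EM) =
    fold (exec_event B) (List.map_filter (proj_event sel_op N) tr) (view_config EM)"
  using assms
proof (induction tr arbitrary: EM)
  case Nil
  then show ?case by simp
next
  case (Cons x tr)
  obtain E M where EM: "EM = (E, M)" by fastforce
  define EM' where "EM' = exec_event A x EM"
  have Rcv: "\<exists>r. M n = Some r \<and> (n \<in> N \<longleftrightarrow> sel_req r \<noteq> None)" if x: "x = Rcv s n" for s n
  proof -
    have "n \<in> dom M" using Cons.prems(1,3) before_in_set x EM by fastforce
    then show ?thesis using Cons.prems(6) EM by auto
  qed
  have step: "view_config EM' = (case proj_event sel_op N x of None \<Rightarrow> view_config EM
     | Some y \<Rightarrow> exec_event B y (view_config EM))"
    unfolding EM'_def EM by (rule view_exec_event) (use Cons.prems(4) Rcv EM in auto)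
  have M': "snd EM' n = snd EM n" if "\<And>s op. x \<noteq> Gen s n op" for n
    using that by (cases x) (auto simp: EM'_def EM split: prod.splits)
  have new: "\<exists>r. snd EM' n = Some r \<and> (sel_req r \<noteq> None \<longleftrightarrow> sel_op op \<noteq> None)"
    if "x = Gen s n op" for s n op
  proof -
    obtain e r where l: "local_step A s op (E s) = (e, r)" by fastforce
    then have "sel_req r \<noteq> None \<longleftrightarrow> sel_op op \<noteq> None"
      using local_Some[OF _ l] local_None[OF _ l] by (cases "sel_op op") auto
    then show ?thesis using that l by (simp add: EM'_def EM)
  qed
  have "view_config (fold (exec_event A) tr EM') =
    fold (exec_event B) (List.map_filter (proj_event sel_op N) tr) (view_config EM')"
  proof (rule Cons.IH)
    show "distinct tr" using Cons.prems(1) by simp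
  next
    fix s s' n op op'
    assume "Gen s n op \<in> set tr" "Gen s' n op' \<in> set tr"
    then show "s = s' \<and> op = op'" by (intro Cons.prems(2)) auto
  next
    fix s n
    assume "Rcv s n \<in> set tr"
    then have "n \<in> dom (snd EM) \<or> (\<exists>s' op. before (x # tr) (Gen s' n op) (Rcv s n))"
      by (intro Cons.prems(3)) auto
    then show "n \<in> dom (snd EM') \<or> (\<exists>s' op. before tr (Gen s' n op) (Rcv s n))"
      using new M' unfolding before_Cons dom_def mem_Collect_eq by (metis option.distinct(1))
  next
    fix s n op
    assume G: "Gen s n op \<in> set tr"
    have "x \<noteq> Gen s' n op'" for s' op'
      using Cons.prems(1) Cons.prems(2)[of s n op s' op'] G by auto
    then show "snd EM' n = None" using M' Cons.prems(4)[of s n op] G by auto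
  next
    fix s n op
    assume "Gen s n op \<in> set tr"
    then show "n \<in> N \<longleftrightarrow> sel_op op \<noteq> None" by (intro Cons.prems(5)) auto
  next
    fix n r
    assume r: "snd EM' n = Some r"
    show "n \<in> N \<longleftrightarrow> sel_req r \<noteq> None"
    proof (cases "\<exists>s op. x = Gen s n op")
      case True
      then show ?thesis using new r Cons.prems(5) by (metis list.set_intros(1) option.inject)
    next
      case False
      then show ?thesis using M' r Cons.prems(6) by auto
    qed
  qed
  then show ?case
    by (simp add: EM'_def[symmetric] step split: option.splits)
qed

theorem view_final_env:
  assumes tr: "computation Obj tr"
  shows "view s (final_env A tr s) = final_env B (project sel_op tr) s"
proof -
  have "view_config (fold (exec_event A) tr (init_env A, Map.empty)) =
    fold (exec_event B) (project sel_op tr) (view_config (init_env A, Map.empty))"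
    unfolding project_def
  proof (rule view_fold_exec_event)
    show "distinct tr" by (rule computation_distinct[OF tr])
  next
    fix s s' n op op'
    assume "Gen s n op \<in> set tr" "Gen s' n op' \<in> set tr"
    then show "s = s' \<and> op = op'" by (rule computation_Gen_unique[OF tr])
  next
    fix s n
    assume "Rcv s n \<in> set tr"
    then show "n \<in> dom (snd (init_env A, Map.empty)) \<or>
      (\<exists>s' op. before tr (Gen s' n op) (Rcv s n))"
      using computation_Rcv[OF tr] by blast
  next
    fix s n op
    assume "Gen s n op \<in> set tr"
    then show "n \<in> selected sel_op tr \<longleftrightarrow> sel_op op \<noteq> None"
      using selected_iff[OF tr, of s n op sel_op] by simp
  qed simp_all
  moreover have "view_config (init_env A, Map.empty) = (init_env B, Map.empty)"
    by (simp add: view_config_def init)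
  moreover have "fst (view_config EM) s = view s (fst EM s)" for EM
    by (simp add: view_config_def case_prod_beta)
  ultimately show ?thesis
    unfolding final_env_def by metis
qed

corollary view_convergent:
  assumes "computation Obj tr" "all_processed tr" "convergent_for Obj' B"
    and "\<And>op op'. op \<in> Ops Obj \<Longrightarrow> sel_op op = Some op' \<Longrightarrow> op' \<in> Ops Obj'"
  shows "state_of B (view s (final_env A tr s)) = state_of B (view s' (final_env A tr s'))"
proof -
  have "computation Obj' (project sel_op tr)"
    using assms(1,4) by (rule computation_project)
  then show ?thesis
    using assms(3) all_processed_project[OF assms(2)]
    unfolding view_final_env[OF assms(1)] convergent_for_def by blast
qed

end


section \<open>The composition\<close>

fun tree_part :: "('opt, 'i, 'opd) data_tree_op \<Rightarrow> 'opt option" where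
  "tree_part (Tree_op op) = Some op"
| "tree_part (Data_op i op) = None"

fun data_part :: "'i \<Rightarrow> ('opt, 'i, 'opd) data_tree_op \<Rightarrow> 'opd option" where
  "data_part j (Tree_op op) = None"
| "data_part j (Data_op i op) = (if i = j then Some op else None)"

fun tree_req_part :: "('rt, 'i, 'rd) comp_req \<Rightarrow> 'rt option" where
  "tree_req_part (Tree_req r) = Some r"
| "tree_req_part (Data_req i r) = None"

fun data_req_part :: "'i \<Rightarrow> ('rt, 'i, 'rd) comp_req \<Rightarrow> 'rd option" where
  "data_req_part j (Tree_req r) = None"
| "data_req_part j (Data_req i r) = (if i = j then Some r else None)"

lemma composition_sel [simp]:
  "Env (composition AT AD d0) =
    {(ET, ED). ET \<in> Env AT \<and> ran ED \<subseteq> Env AD \<and> Dom (state_of AT ET) \<subseteq> dom ED}"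
  "Req (composition AT AD d0) = Tree_req ` Req AT \<union> {Data_req i r | i r. r \<in> Req AD}"
  "init_env (composition AT AD d0) s = (init_env AT s, Map.empty)"
  "state_of (composition AT AD d0) = comp_state AT AD d0"
  "local_step (composition AT AD d0) = comp_local AT AD"
  "ext_step (composition AT AD d0) = comp_ext AT AD"
  by (simp_all add: composition_def)

lemma data_env_cover [simp]: "data_env AD s (cover AD s I ED) i = data_env AD s ED i"
  by (simp add: data_env_def cover_def)

lemma data_env_upd [simp]:
  "data_env AD s (ED(j \<mapsto> e)) i = (if i = j then e else data_env AD s ED i)"
  by (simp add: data_env_def)

lemma dom_cover [simp]: "dom (cover AD s I ED) = I \<union> dom ED"
  by (auto simp: cover_def)

lemma data_env_in_Env:
  "init_env AD s \<in> Env AD \<Longrightarrow> ran ED \<subseteq> Env AD \<Longrightarrow> data_env AD s ED i \<in> Env AD"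
  by (auto simp: data_env_def ran_def split: option.splits)

lemma ran_cover:
  "init_env AD s \<in> Env AD \<Longrightarrow> ran ED \<subseteq> Env AD \<Longrightarrow> ran (cover AD s I ED) \<subseteq> Env AD"
  using data_env_in_Env[of AD s ED] by (auto simp: cover_def ran_def split: if_splits)

lemma ran_upd: "ran ED \<subseteq> S \<Longrightarrow> e \<in> S \<Longrightarrow> ran (ED(i \<mapsto> e)) \<subseteq> S"
  by (auto simp: ran_def)

lemma tree_component:
  fixes AT :: "('s, ('l, 'i) tree, ('l, 'i) tree_op, 'et, 'rt) algorithm"
    and AD :: "('s, 'd, 'opd, 'ed, 'rd) algorithm"
  shows "component (composition AT AD d0) AT tree_part tree_req_part (\<lambda>s. fst)"
proof
  fix op op' s e e' r
  assume "tree_part op = Some op'" "local_step (composition AT AD d0) s op e = (e', r)"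
  then show "\<exists>r'. tree_req_part r = Some r' \<and> local_step AT s op' (fst e) = (fst e', r')"
    by (cases op; cases e) (auto split: prod.splits)
next
  fix op s e e' r
  assume "tree_part op = None" "local_step (composition AT AD d0) s op e = (e', r)"
  then show "tree_req_part r = None \<and> fst e' = fst e"
    by (cases op; cases e) (auto split: prod.splits)
next
  fix r :: "('rt, 'i, 'rd) comp_req" and r' s e
  assume "tree_req_part r = Some r'"
  then show "fst (ext_step (composition AT AD d0) s r e) = ext_step AT s r' (fst e)"
    by (cases r; cases e) (auto simp: Let_def)
next
  fix r :: "('rt, 'i, 'rd) comp_req" and s e
  assume "tree_req_part r = None"
  then show "fst (ext_step (composition AT AD d0) s r e) = fst e"
    by (cases r; cases e) auto
qed simp

lemma data_component:
  fixes AT :: "('s, ('l, 'i) tree, ('l, 'i) tree_op, 'et, 'rt) algorithm"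
    and AD :: "('s, 'd, 'opd, 'ed, 'rd) algorithm"
  shows "component (composition AT AD d0) AD (data_part i) (data_req_part i)
     (\<lambda>s e. data_env AD s (snd e) i)"
proof
  fix s
  show "data_env AD s (snd (init_env (composition AT AD d0) s)) i = init_env AD s"
    by (simp add: data_env_def)
next
  fix op op' s e e' r
  assume "data_part i op = Some op'" "local_step (composition AT AD d0) s op e = (e', r)"
  then show "\<exists>r'. data_req_part i r = Some r' \<and>
      local_step AD s op' (data_env AD s (snd e) i) = (data_env AD s (snd e') i, r')"
    by (cases op; cases e) (auto split: prod.splits if_splits)
next
  fix op s e e' r
  assume "data_part i op = None" "local_step (composition AT AD d0) s op e = (e', r)"
  then show "data_req_part i r = None \<and> data_env AD s (snd e') i = data_env AD s (snd e) i"
    by (cases op; cases e) (auto split: prod.splits if_splits)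
next
  fix r :: "('rt, 'i, 'rd) comp_req" and r' s e
  assume "data_req_part i r = Some r'"
  then show "data_env AD s (snd (ext_step (composition AT AD d0) s r e)) i =
      ext_step AD s r' (data_env AD s (snd e) i)"
    by (cases r; cases e) (auto split: if_splits)
next
  fix r :: "('rt, 'i, 'rd) comp_req" and s e
  assume "data_req_part i r = None"
  then show "data_env AD s (snd (ext_step (composition AT AD d0) s r e)) i =
      data_env AD s (snd e) i"
    by (cases r; cases e) (auto simp: Let_def split: if_splits)
qed

lemma collaborative_object_data_tree:
  assumes "collaborative_object Data" "d0 \<in> States Data"
  shows "collaborative_object (data_tree_object Data d0)" (is "collaborative_object ?Obj")
  unfolding collaborative_object_def
proof (intro ballI)
  fix x op
  assume x: "x \<in> States ?Obj" and op: "op \<in> Ops ?Obj"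
  obtain t \<delta> where t: "x = (t, \<delta>)" "t \<in> States tree_object" "range \<delta> \<subseteq> States Data"
    using x by (auto simp: data_tree_object_def)
  show "Do ?Obj x op \<in> States ?Obj"
  proof (cases op)
    case (Tree_op a)
    then show ?thesis
      using t op assms(2) collaborative_object_tree
      by (auto simp: data_tree_object_def collaborative_object_def Let_def)
  next
    case (Data_op i a)
    then show ?thesis
      using t op assms(1)
      by (auto simp: data_tree_object_def collaborative_object_def fun_upd_def)
  qed
qed

lemma editing_algorithm_composition:
  assumes T: "editing_algorithm tree_object (Tree {||}) AT"
    and D: "editing_algorithm Data d0 AD"
  shows "editing_algorithm (data_tree_object Data d0) (Tree {||}, \<lambda>_. d0) (composition AT AD d0)"
    (is "editing_algorithm ?Obj ?x0 ?A")
proof -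
  note T' = T[unfolded editing_algorithm_def]
  note D' = D[unfolded editing_algorithm_def]
  have obj: "collaborative_object ?Obj"
    using D' by (intro collaborative_object_data_tree) auto
  have init: "init_env AD s \<in> Env AD" for s using D' by blast
  have "comp_state AT AD d0 e \<in> States ?Obj"
    if env: "e \<in> Env ?A" for e
  proof -
    obtain ET ED where e: "e = (ET, ED)" "ET \<in> Env AT" "ran ED \<subseteq> Env AD"
      "Dom (state_of AT ET) \<subseteq> dom ED"
      using env by auto
    have "state_of AD (the (ED i)) \<in> States Data" if "i \<in> Dom (state_of AT ET)" for i
    proof -
      have "i \<in> dom ED" using \<open>i \<in> Dom (state_of AT ET)\<close> e(4) by blast
      then obtain b where "ED i = Some b" by blast
      then show ?thesis using e(3) D' by (auto intro: ranI)
    qed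
    then show ?thesis using e T' D' by (auto simp: data_tree_object_def)
  qed
  moreover have "comp_local AT AD s op e \<in> Env ?A \<times> Req ?A"
    if op: "op \<in> Ops ?Obj" and env: "e \<in> Env ?A" for s op e
  proof -
    obtain ET ED where e: "e = (ET, ED)" "ET \<in> Env AT" "ran ED \<subseteq> Env AD"
      "Dom (state_of AT ET) \<subseteq> dom ED"
      using env by auto
    show ?thesis
    proof (cases op)
      case (Tree_op a)
      then have "local_step AT s a ET \<in> Env AT \<times> Req AT"
        using op e T' by (auto simp: data_tree_object_def)
      then show ?thesis
        using ran_cover[OF init e(3)] by (auto simp: Tree_op e(1) split: prod.splits)
    next
      case (Data_op i a)
      then have "local_step AD s a (data_env AD s ED i) \<in> Env AD \<times> Req AD"
        using op D' data_env_in_Env[OF init e(3)] by (auto simp: data_tree_object_def)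
      then obtain e' r where l: "local_step AD s a (data_env AD s ED i) = (e', r)"
        "e' \<in> Env AD" "r \<in> Req AD"
        by blast
      then show ?thesis
        using e ran_upd[OF e(3) l(2), of i] by (auto simp: Data_op)
    qed
  qed
  moreover have "comp_ext AT AD s r e \<in> Env ?A"
    if r: "r \<in> Req ?A" and env: "e \<in> Env ?A" for s r e
  proof -
    obtain ET ED where e: "e = (ET, ED)" "ET \<in> Env AT" "ran ED \<subseteq> Env AD"
      "Dom (state_of AT ET) \<subseteq> dom ED"
      using env by auto
    show ?thesis
    proof (cases r)
      case (Tree_req a)
      then have "ext_step AT s a ET \<in> Env AT" using r e T' by auto
      then show ?thesis
        using ran_cover[OF init e(3)] by (auto simp: Tree_req e(1) Let_def)
    next
      case (Data_req i a)
      then have "ext_step AD s a (data_env AD s ED i) \<in> Env AD"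
        using r D' data_env_in_Env[OF init e(3)] by auto
      then show ?thesis
        using e ran_upd[OF e(3)] by (auto simp: Data_req)
    qed
  qed
  moreover have "?x0 \<in> States ?Obj"
    using T' D' by (auto simp: data_tree_object_def)
  ultimately show ?thesis
    using obj T' unfolding editing_algorithm_def by (auto simp: Dom_Tree)
qed

lemma Dom_subset_dom_exec_event:
  assumes "\<And>s. Dom (state_of AT (fst (fst EM s))) \<subseteq> dom (snd (fst EM s))"
  shows "Dom (state_of AT (fst (fst (exec_event (composition AT AD d0) x EM) s))) \<subseteq>
    dom (snd (fst (exec_event (composition AT AD d0) x EM) s))"
proof -
  obtain E M where EM: "EM = (E, M)" by fastforce
  have step: "Dom (state_of AT (fst (fst (comp_local AT AD s op e)))) \<subseteq>
      dom (snd (fst (comp_local AT AD s op e)))"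
    if "Dom (state_of AT (fst e)) \<subseteq> dom (snd e)" for s op e
    using that by (cases op; cases e) (auto simp: Let_def split: prod.splits)
  have ext: "Dom (state_of AT (fst (comp_ext AT AD s r e))) \<subseteq> dom (snd (comp_ext AT AD s r e))"
    if "Dom (state_of AT (fst e)) \<subseteq> dom (snd e)" for s r e
    using that by (cases r; cases e) (auto simp: Let_def)
  show ?thesis
  proof (cases x)
    case (Gen s' n op)
    then show ?thesis
      using assms[of s] step[of "E s'" s' op] assms[of s'] by (auto simp: EM split: prod.splits)
  next
    case (Rcv s' n)
    then show ?thesis
      using assms[of s] ext[of "E s'" s' "the (M n)"] assms[of s'] by (auto simp: EM)
  qed
qed

lemma Dom_subset_dom_final_env:
  assumes "editing_algorithm tree_object (Tree {||}) AT"
  shows "Dom (state_of AT (fst (final_env (composition AT AD d0) tr s))) \<subseteq>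
    dom (snd (final_env (composition AT AD d0) tr s))"
proof -
  have "Dom (state_of AT (fst (fst (fold (exec_event (composition AT AD d0)) tr EM) s))) \<subseteq>
      dom (snd (fst (fold (exec_event (composition AT AD d0)) tr EM) s))"
    if "\<And>s. Dom (state_of AT (fst (fst EM s))) \<subseteq> dom (snd (fst EM s))" for EM
    using that
  proof (induction tr arbitrary: EM)
    case (Cons x tr)
    show ?case
      unfolding fold_simps by (rule Cons.IH) (rule Dom_subset_dom_exec_event[OF Cons.prems])
  qed simp
  then show ?thesis
    using assms by (simp add: final_env_def editing_algorithm_def Dom_Tree)
qed

lemma comp_state_eq:
  assumes "Dom (state_of AT (fst e)) \<subseteq> dom (snd e)"
  shows "comp_state AT AD d0 e = (state_of AT (fst e),
    \<lambda>i. if i \<in> Dom (state_of AT (fst e)) then state_of AD (data_env AD s (snd e) i) else d0)"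
  using assms by (cases e) (auto simp: data_env_def fun_eq_iff split: option.splits)

lemma convergent_composition:
  fixes AT :: "('s, ('l, 'i) tree, ('l, 'i) tree_op, 'et, 'rt) algorithm"
    and AD :: "('s, 'd, 'opd, 'ed, 'rd) algorithm"
  assumes T: "editing_algorithm tree_object (Tree {||}) AT" "convergent_for tree_object AT"
    and D: "convergent_for Data AD"
  shows "convergent_for (data_tree_object Data d0) (composition AT AD d0)"
  unfolding convergent_for_def
proof (intro allI impI)
  fix tr :: "('s, (('l, 'i) tree_op, 'i, 'opd) data_tree_op) event list" and s s'
  assume tr: "computation (data_tree_object Data d0) tr" "all_processed tr"
  let ?e = "final_env (composition AT AD d0) tr"
  interpret tree: component "composition AT AD d0" AT tree_part tree_req_part "\<lambda>s. fst"
    by (rule tree_component)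
  have "state_of AT (fst (?e s)) = state_of AT (fst (?e s'))"
    by (rule tree.view_convergent[OF tr T(2)]) (auto simp: tree_object_def)
  moreover have "state_of AD (data_env AD s (snd (?e s)) i) =
    state_of AD (data_env AD s' (snd (?e s')) i)" for i
  proof -
    interpret data: component "composition AT AD d0" AD "data_part i" "data_req_part i"
      "\<lambda>s e. data_env AD s (snd e) i"
      by (rule data_component)
    show ?thesis
      by (rule data.view_convergent[OF tr D]) (auto simp: data_tree_object_def split: if_splits)
  qed
  moreover have "comp_state AT AD d0 (?e u) = (state_of AT (fst (?e u)),
      \<lambda>i. if i \<in> Dom (state_of AT (fst (?e u)))
        then state_of AD (data_env AD u (snd (?e u)) i) else d0)" for u
    using Dom_subset_dom_final_env[OF T(1)] by (rule comp_state_eq)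
  ultimately show "state_of (composition AT AD d0) (?e s) = state_of (composition AT AD d0) (?e s')"
    by (simp cong: if_cong)
qed

theorem theorem5:
  fixes AT :: "('s::finite, ('l, 'i) tree, ('l, 'i) tree_op, 'et, 'rt) algorithm"
    and AD :: "('s, 'd, 'opd, 'ed, 'rd) algorithm"
    and Data :: "('d, 'opd) collab_object"
    and d0 :: 'd
  assumes "editing_algorithm tree_object (Tree {||}) AT"
    and "convergent_for tree_object AT"
    and "editing_algorithm Data d0 AD"
    and "convergent_for Data AD"
  shows "editing_algorithm (data_tree_object Data d0) (Tree {||}, \<lambda>_. d0) (composition AT AD d0)
       \<and> convergent_for (data_tree_object Data d0) (composition AT AD d0)"
  using editing_algorithm_composition[OF assms(1,3)] convergent_composition[OF assms(1,2,4)] ..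

end
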